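(* Let $X$ be a Hausdorff locally convex space, let $T:X\rightrightarrows X^{*}$, and let $V\subset X$ be non-empty, algebraically open (i.e. $V=\operatorname{core}V$) and convex, such that $T|_{V}$ is a non-void monotone operator and $T$ is $V$-NI. Then \[ [\psi_{T|_{V}}=c]\cap (V\times X^{*})=[\varphi_{T|_{V}}=c]\cap (V\times X^{*})=[\varphi_{T|_{V}}\le c]\cap (V\times X^{*}), \] and this set is the unique $V$-representable extension and the unique maximal monotone extension in $V\times X^{*}$ of $T|_{V}$. If, in addition, $T$ is a non-void monotone operator, then moreover \[ [\psi_{T|_{V}}=c]\cap (V\times X^{*})=[\varphi_{T}=c]\cap (V\times X^{*})=[\psi_{T}=c]\cap (V\times X^{*}). \] If, in addition, $T$ is a non-void monotone operator and $T$ is $V$-representable, then $V$ identifies $T$ and \[ [\psi_{T|_{V}}=c]\cap (V\times X^{*})=[\varphi_{T|_{V}}=c]\cap (V\times X^{*})=[\varphi_{T|_{V}}\le c]\cap (V\times X^{*})=[\varphi_{T}=c]\cap (V\times X^{*})=[\psi_{T}=c]\cap (V\times X^{*})=\operatorname{Graph}(T|_{V}). \]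
   Context: $X$ is a non-trivial Hausdorff locally convex space with topology $\tau$, $X^{*}$ its dual with the weak-star topology $w^{*}$, $Z=X\times X^{*}$, and $c(x,x^{*})=\langle x,x^{*}\rangle$ is the duality coupling. For $T\subset X\times X^{*}$ and $V\subset X$, $T|_{V}$ is the operator with $\operatorname{Graph}T|_{V}=\operatorname{Graph}T\cap(V\times X^{*})$. The Fitzpatrick function is $\varphi_{T}(x,x^{*})=\sup\{\langle x,u^{*}\rangle+\langle u,x^{*}\rangle-\langle u,u^{*}\rangle\mid (u,u^{*})\in T\}$, and $\psi_{T}$ is the $\tau\times w^{*}$-lower semicontinuous convex hull of $c+\iota_{\operatorname{Graph}T}$. For functions $f,g$, $[f\le g]=\{z\mid f(z)\le g(z)\}$, similarly $[f=g]$. $T$ is $V$-NI if $\varphi_{T|_{V}}\ge c$ on $V\times X^{*}$. $T$ is $V$-representable if $V\cap D(T)\ne\emptyset$ and there is a proper convex $\tau\times w^{*}$-lsc $h\ge c$ on $Z$ with $[h=c]\cap(V\times X^{*})=\operatorname{Graph}(T|_{V})$. $V$ identifies $T$ if every $(x,x^{*})\in V\times X^{*}$ with $\varphi_{T|_{V}}(x,x^{*})\le \langle x,x^{*}\rangle$ (i.e. monotonically related to $T|_V$) belongs to $\operatorname{Graph}T$. *)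

theory Defs
  imports "HOL-Analysis.Analysis"
begin

definition lcs :: "'x::real_vector topology \<Rightarrow> bool" where
  "lcs tau \<longleftrightarrow> topspace tau = UNIV \<and> Hausdorff_space tau \<and>
     continuous_map (prod_topology tau tau) tau (\<lambda>(x,y). x + y) \<and>
     continuous_map (prod_topology euclideanreal tau) tau (\<lambda>(a,x). a *\<^sub>R x) \<and>
     (\<forall>U. openin tau U \<and> 0 \<in> U \<longrightarrow> (\<exists>W. openin tau W \<and> convex W \<and> 0 \<in> W \<and> W \<subseteq> U))"

definition dual :: "'x::real_vector topology \<Rightarrow> ('x \<Rightarrow> real) set" where
  "dual tau = {f. linear f \<and> continuous_map tau euclideanreal f}"

definition wstar :: "'x::real_vector topology \<Rightarrow> ('x \<Rightarrow> real) topology" where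
  "wstar tau = subtopology (powertop_real UNIV) (dual tau)"

definition Ztop :: "'x::real_vector topology \<Rightarrow> ('x \<times> ('x \<Rightarrow> real)) topology" where
  "Ztop tau = prod_topology tau (wstar tau)"

definition cpl :: "'x \<times> ('x \<Rightarrow> real) \<Rightarrow> real" where
  "cpl z = snd z (fst z)"

definition restr :: "('x \<times> ('x \<Rightarrow> real)) set \<Rightarrow> 'x set \<Rightarrow> ('x \<times> ('x \<Rightarrow> real)) set" where
  "restr T V = T \<inter> (V \<times> UNIV)"

definition dom_op :: "('x \<times> 'y) set \<Rightarrow> 'x set" where
  "dom_op T = fst ` T"

definition monotone_op :: "('x::real_vector \<times> ('x \<Rightarrow> real)) set \<Rightarrow> bool" where
  "monotone_op T \<longleftrightarrow> (\<forall>(x,xs)\<in>T. \<forall>(y,ys)\<in>T. (xs x - xs y) - (ys x - ys y) \<ge> 0)"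

text \<open>Fitzpatrick function (extended-real valued; -infinity for the empty operator).\<close>
definition fitz :: "('x \<times> ('x \<Rightarrow> real)) set \<Rightarrow> 'x \<times> ('x \<Rightarrow> real) \<Rightarrow> ereal" where
  "fitz T z = (SUP p\<in>T. ereal (snd p (fst z) + snd z (fst p) - snd p (fst p)))"

definition zcomb :: "real \<Rightarrow> 'x::real_vector \<times> ('x \<Rightarrow> real) \<Rightarrow> 'x \<times> ('x \<Rightarrow> real) \<Rightarrow> 'x \<times> ('x \<Rightarrow> real)" where
  "zcomb t z1 z2 = (t *\<^sub>R fst z1 + (1 - t) *\<^sub>R fst z2, \<lambda>y. t * snd z1 y + (1 - t) * snd z2 y)"

text \<open>Convexity of an extended-real function on Z (convex epigraph).\<close>
definition convex_onZ :: "'x::real_vector topology \<Rightarrow> ('x \<times> ('x \<Rightarrow> real) \<Rightarrow> ereal) \<Rightarrow> bool" where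
  "convex_onZ tau g \<longleftrightarrow> (\<forall>z1\<in>UNIV \<times> dual tau. \<forall>z2\<in>UNIV \<times> dual tau. \<forall>r1 r2 t::real.
      0 \<le> t \<and> t \<le> 1 \<and> g z1 \<le> ereal r1 \<and> g z2 \<le> ereal r2 \<longrightarrow>
      g (zcomb t z1 z2) \<le> ereal (t * r1 + (1 - t) * r2))"

definition lsc_onZ :: "'x::real_vector topology \<Rightarrow> ('x \<times> ('x \<Rightarrow> real) \<Rightarrow> ereal) \<Rightarrow> bool" where
  "lsc_onZ tau g \<longleftrightarrow> (\<forall>r::real. closedin (Ztop tau) {z \<in> topspace (Ztop tau). g z \<le> ereal r})"

definition proper_onZ :: "'x::real_vector topology \<Rightarrow> ('x \<times> ('x \<Rightarrow> real) \<Rightarrow> ereal) \<Rightarrow> bool" where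
  "proper_onZ tau g \<longleftrightarrow> (\<forall>z\<in>UNIV \<times> dual tau. g z \<noteq> -\<infinity>) \<and> (\<exists>z\<in>UNIV \<times> dual tau. g z \<noteq> \<infinity>)"

definition cind :: "('x \<times> ('x \<Rightarrow> real)) set \<Rightarrow> 'x \<times> ('x \<Rightarrow> real) \<Rightarrow> ereal" where
  "cind T z = (if z \<in> T then ereal (cpl z) else \<infinity>)"

definition psi :: "'x::real_vector topology \<Rightarrow> ('x \<times> ('x \<Rightarrow> real)) set \<Rightarrow> 'x \<times> ('x \<Rightarrow> real) \<Rightarrow> ereal" where
  "psi tau T z = Sup {g z | g. convex_onZ tau g \<and> lsc_onZ tau g \<and>
                               (\<forall>w\<in>UNIV \<times> dual tau. g w \<le> cind T w)}"

definition core :: "'x::real_vector set \<Rightarrow> 'x set" where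
  "core V = {x\<in>V. \<forall>y. \<exists>e>0. \<forall>t. 0 \<le> t \<and> t \<le> e \<longrightarrow> x + t *\<^sub>R y \<in> V}"

definition V_NI :: "'x::real_vector topology \<Rightarrow> ('x \<times> ('x \<Rightarrow> real)) set \<Rightarrow> 'x set \<Rightarrow> bool" where
  "V_NI tau T V \<longleftrightarrow> (\<forall>z\<in>V \<times> dual tau. fitz (restr T V) z \<ge> ereal (cpl z))"

definition V_representable :: "'x::real_vector topology \<Rightarrow> ('x \<times> ('x \<Rightarrow> real)) set \<Rightarrow> 'x set \<Rightarrow> bool" where
  "V_representable tau T V \<longleftrightarrow> V \<inter> dom_op T \<noteq> {} \<and>
     (\<exists>h. proper_onZ tau h \<and> convex_onZ tau h \<and> lsc_onZ tau h \<and>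
          (\<forall>z\<in>UNIV \<times> dual tau. h z \<ge> ereal (cpl z)) \<and>
          {z \<in> V \<times> dual tau. h z = ereal (cpl z)} = restr T V)"

definition identifies :: "'x::real_vector topology \<Rightarrow> 'x set \<Rightarrow> ('x \<times> ('x \<Rightarrow> real)) set \<Rightarrow> bool" where
  "identifies tau V T \<longleftrightarrow> (\<forall>z\<in>V \<times> dual tau. fitz (restr T V) z \<le> ereal (cpl z) \<longrightarrow> z \<in> T)"

definition maxmon_ext_in :: "('x::real_vector \<times> ('x \<Rightarrow> real)) set \<Rightarrow> ('x \<times> ('x \<Rightarrow> real)) set \<Rightarrow> ('x \<times> ('x \<Rightarrow> real)) set \<Rightarrow> bool" where
  "maxmon_ext_in R T S \<longleftrightarrow> T \<subseteq> S \<and> S \<subseteq> R \<and> monotone_op S \<and>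
     (\<forall>S'. S \<subseteq> S' \<and> S' \<subseteq> R \<and> monotone_op S' \<longrightarrow> S' = S)"

definition Vrep_ext :: "'x::real_vector topology \<Rightarrow> 'x set \<Rightarrow> ('x \<times> ('x \<Rightarrow> real)) set \<Rightarrow> ('x \<times> ('x \<Rightarrow> real)) set \<Rightarrow> bool" where
  "Vrep_ext tau V T S \<longleftrightarrow> T \<subseteq> S \<and> S \<subseteq> V \<times> dual tau \<and> V_representable tau S V"

end

theory Submission
  imports Defs "HOL-Library.Function_Algebras"
begin

text \<open>
  Write \<open>A = T|\<^sub>V\<close>, \<open>\<phi> = \<phi>\<^sub>A\<close> and \<open>\<psi> = \<psi>\<^sub>A\<close>. Monotonicity of \<open>A\<close> gives \<open>\<phi> \<le> \<psi>\<close>, and with Fenchel's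
  inequality also \<open>c \<le> \<psi>\<close>. The crucial point is that \<open>\<phi>(z) \<le> c(z)\<close> forces \<open>\<psi>(z) \<le> c(z)\<close> for
  \<open>z \<in> V \<times> X\<^sup>*\<close>: since \<open>V\<close> is algebraically open, \<open>\<phi> \<ge> c\<close> holds on an initial piece of every segment
  issuing from \<open>z\<close>, and comparing slopes at \<open>z\<close> yields \<open>\<phi>(w) \<ge> z \<cdot> w - c(z)\<close> for every \<open>w\<close>. This
  says that no affine continuous minorant of \<open>c + \<iota>\<^sub>A\<close> exceeds \<open>c(z)\<close> at \<open>z\<close>, and by Hahn--Banach
  separation from the epigraph no convex lsc minorant does either.

  The separation takes place in \<open>X \<times> \<real>\<^sup>X \<times> \<real>\<close>, which contains \<open>X \<times> X\<^sup>* \<times> \<real>\<close> with the subspace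
  topology and whose middle factor has a completely explicit dual.
\<close>

section \<open>Hahn--Banach separation\<close>

text \<open>This makes the product of \<open>'x\<close>, \<open>'x \<Rightarrow> real\<close> and
  \<open>real\<close> a real vector space, which the algebraic separation argument needs.\<close>

instantiation "fun" :: (type, real_vector) real_vector
begin

definition scaleR_fun_def: "r *\<^sub>R f = (\<lambda>x. r *\<^sub>R f x)"

instance
  by standard (simp_all add: scaleR_fun_def fun_eq_iff algebra_simps)

end

lemma scaleR_fun_apply [simp]: "(r *\<^sub>R f) x = r *\<^sub>R f x"
  by (simp add: scaleR_fun_def)

section \<open>Linear functionals below sublinear ones\<close>

definition sublinear :: "('a::real_vector \<Rightarrow> real) \<Rightarrow> bool" where
  "sublinear p \<longleftrightarrow> (\<forall>x y. p (x + y) \<le> p x + p y) \<and> (\<forall>t x. 0 < t \<longrightarrow> p (t *\<^sub>R x) = t * p x)"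

lemma sublinear_add: "sublinear p \<Longrightarrow> p (x + y) \<le> p x + p y"
  by (simp add: sublinear_def)

lemma sublinear_scale: "sublinear p \<Longrightarrow> 0 < t \<Longrightarrow> p (t *\<^sub>R x) = t * p x"
  by (simp add: sublinear_def)

lemma sublinear_zero:
  assumes "sublinear p" shows "p 0 = 0"
  using sublinear_scale[OF assms, of 2 0] by simp

lemma sublinear_minus:
  assumes "sublinear p" shows "- p (- x) \<le> p x"
  using sublinear_add[OF assms, of x "- x"] sublinear_zero[OF assms] by simp

text \<open>The inequality for the factor \<open>inverse t\<close> at the point
  \<open>t *\<^sub>R x\<close> reverses the one for \<open>t\<close>.\<close>

lemma sublinearI:
  assumes "\<And>x y. p (x + y) \<le> p x + p y"
    and "\<And>t x. 0 < t \<Longrightarrow> p (t *\<^sub>R x) \<le> t * p x"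
  shows "sublinear p"
  unfolding sublinear_def
proof (intro conjI allI impI)
  fix t :: real and x assume t: "0 < t"
  have "p (inverse t *\<^sub>R t *\<^sub>R x) \<le> inverse t * p (t *\<^sub>R x)"
    using t by (intro assms(2)) simp
  hence "t * p x \<le> p (t *\<^sub>R x)"
    using t by (simp add: field_simps)
  with assms(2)[OF t] show "p (t *\<^sub>R x) = t * p x"
    by (meson order_antisym)
qed (rule assms(1))

text \<open>Zorn's lemma: the pointwise infimum of a non-empty chain is finite, since every member
  stays above \<open>- p (- x)\<close>, and subadditive, since of two members of the chain one lies
  below the other.\<close>

lemma ex_minimal_sublinear:
  fixes p :: "'a::real_vector \<Rightarrow> real"
  assumes p: "sublinear p"
  shows "\<exists>m. sublinear m \<and> m \<le> p \<and> (\<forall>q. sublinear q \<and> q \<le> m \<longrightarrow> q = m)"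
proof -
  define A where "A = {q. sublinear q \<and> q \<le> p}"
  \<comment> \<open>The order is reversed because the Zorn rule yields maximal elements.\<close>
  have po: "partial_order_on A (relation_of (\<ge>) A)"
    by (rule partial_order_on_relation_ofI) auto
  have "\<exists>u\<in>A. \<forall>a\<in>C. u \<le> a" if C: "C \<in> Chains (relation_of (\<ge>) A)" for C
  proof (cases "C = {}")
    case True
    thus ?thesis using p by (auto simp: A_def)
  next
    case False
    have CA: "q \<in> A" if "q \<in> C" for q
      using C that by (auto simp: Chains_def relation_of_def)
    have tot: "q \<le> r \<or> r \<le> q" if "q \<in> C" "r \<in> C" for q r
      using C that by (auto simp: Chains_def relation_of_def)
    define u where "u = (\<lambda>x. INF q\<in>C. q x)"
    have bdd: "bdd_below ((\<lambda>q. q x) ` C)" for x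
    proof (rule bdd_belowI2)
      fix q assume "q \<in> C"
      hence "sublinear q" "q (- x) \<le> p (- x)" using CA by (auto simp: A_def le_fun_def)
      thus "- p (- x) \<le> q x" using sublinear_minus[of q x] by linarith
    qed
    have lb: "u x \<le> q x" if "q \<in> C" for q x
      unfolding u_def by (rule cINF_lower[OF bdd that])
    have gb: "c \<le> u x" if "\<And>q. q \<in> C \<Longrightarrow> c \<le> q x" for c x
      unfolding u_def by (rule cINF_greatest[OF False that])
    have "sublinear u"
    proof (rule sublinearI)
      fix x y
      have *: "u (x + y) \<le> q x + r y" if qr: "q \<in> C" "r \<in> C" for q r
      proof -
        obtain s where s: "s \<in> C" "s \<le> q" "s \<le> r" using tot[OF qr] qr by blast
        have "u (x + y) \<le> s (x + y)" by (rule lb[OF s(1)])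
        also have "\<dots> \<le> s x + s y" using CA[OF s(1)] by (simp add: A_def sublinear_add)
        also have "\<dots> \<le> q x + r y" using s by (simp add: le_fun_def add_mono)
        finally show ?thesis .
      qed
      \<comment> \<open>The two infima are taken one after the other, each time with the other
        member held fixed.\<close>
      have "u (x + y) - q x \<le> u y" if "q \<in> C" for q
        by (rule gb) (use *[OF that] in \<open>simp add: algebra_simps\<close>)
      hence "u (x + y) - u y \<le> u x" by (intro gb) (simp add: algebra_simps)
      thus "u (x + y) \<le> u x + u y" by simp
    next
      fix t :: real and x :: 'a assume t: "0 < t"
      have "u (t *\<^sub>R x) / t \<le> u x"
      proof (rule gb)
        fix q assume q: "q \<in> C"
        have "u (t *\<^sub>R x) \<le> t * q x"
          using lb[OF q, of "t *\<^sub>R x"] CA[OF q] t by (simp add: A_def sublinear_scale)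
        thus "u (t *\<^sub>R x) / t \<le> q x" using t by (simp add: field_simps)
      qed
      thus "u (t *\<^sub>R x) \<le> t * u x" using t by (simp add: field_simps)
    qed
    moreover have "u \<le> p"
    proof -
      obtain q where "q \<in> C" using False by blast
      thus ?thesis using lb CA by (fastforce simp: A_def le_fun_def intro: order_trans)
    qed
    ultimately show ?thesis using lb by (auto simp: A_def le_fun_def)
  qed
  from predicate_Zorn[OF po this] obtain m where
    m: "m \<in> A" "\<forall>q\<in>A. q \<le> m \<longrightarrow> q = m" by blast
  have "q = m" if "sublinear q" "q \<le> m" for q
    using m that by (auto simp: A_def)
  thus ?thesis using m(1) by (auto simp: A_def)
qed

text \<open>For fixed \<open>y\<close>, the infimum over \<open>t \<ge> 0\<close> of
  \<open>p (x + t *\<^sub>R y) - t * p y\<close> is sublinear in \<open>x\<close> and below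
  \<open>p\<close>, so it equals \<open>p\<close> by minimality; \<open>t = 1\<close> then gives
  superadditivity.\<close>

lemma minimal_sublinear_imp_linear:
  fixes p :: "'a::real_vector \<Rightarrow> real"
  assumes p: "sublinear p" and min: "\<And>q. sublinear q \<Longrightarrow> q \<le> p \<Longrightarrow> q = p"
  shows "linear p"
proof -
  have ge: "p x + p y \<le> p (x + y)" for x y
  proof -
    define Q where "Q = (\<lambda>x. (\<lambda>t. p (x + t *\<^sub>R y) - t * p y) ` {0..})"
    define q where "q = (\<lambda>x. Inf (Q x))"
    have bdd: "bdd_below (Q x)" for x
      unfolding Q_def
    proof (rule bdd_belowI2)
      fix t :: real assume "t \<in> {0..}"
      hence "p (t *\<^sub>R y) = t * p y"
        using sublinear_scale[OF p] sublinear_zero[OF p] by (cases "t = 0") auto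
      thus "- p (- x) \<le> p (x + t *\<^sub>R y) - t * p y"
        using sublinear_add[OF p, of "x + t *\<^sub>R y" "- x"] by simp
    qed
    have lb: "q x \<le> p (x + t *\<^sub>R y) - t * p y" if "0 \<le> t" for x t
      unfolding q_def using that by (intro cInf_lower bdd) (auto simp: Q_def)
    have gb: "c \<le> q x" if "\<And>t. 0 \<le> t \<Longrightarrow> c \<le> p (x + t *\<^sub>R y) - t * p y" for c x
      unfolding q_def using that by (intro cInf_greatest) (auto simp: Q_def)
    have "sublinear q"
    proof (rule sublinearI)
      fix a b
      have *: "q (a + b) \<le> (p (a + s *\<^sub>R y) - s * p y) + (p (b + t *\<^sub>R y) - t * p y)"
        if "0 \<le> s" "0 \<le> t" for s t
      proof -
        have "q (a + b) \<le> p ((a + b) + (s + t) *\<^sub>R y) - (s + t) * p y"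
          using that by (intro lb) simp
        moreover have "p ((a + b) + (s + t) *\<^sub>R y) \<le> p (a + s *\<^sub>R y) + p (b + t *\<^sub>R y)"
          using sublinear_add[OF p, of "a + s *\<^sub>R y" "b + t *\<^sub>R y"] by (simp add: algebra_simps)
        ultimately show ?thesis by (simp add: algebra_simps)
      qed
      have "q (a + b) - (p (a + s *\<^sub>R y) - s * p y) \<le> q b" if "0 \<le> s" for s
        by (rule gb) (use *[OF that] in \<open>simp add: algebra_simps\<close>)
      hence "q (a + b) - q b \<le> q a" by (intro gb) (simp add: algebra_simps)
      thus "q (a + b) \<le> q a + q b" by simp
    next
      fix t :: real and a assume t: "0 < t"
      have "q (t *\<^sub>R a) / t \<le> q a"
      proof (rule gb)
        fix s :: real assume s: "0 \<le> s"
        have "q (t *\<^sub>R a) \<le> p (t *\<^sub>R a + (t * s) *\<^sub>R y) - (t * s) * p y"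
          using s t by (intro lb) simp
        also have "p (t *\<^sub>R a + (t * s) *\<^sub>R y) = t * p (a + s *\<^sub>R y)"
          using sublinear_scale[OF p t, of "a + s *\<^sub>R y"] by (simp add: algebra_simps)
        finally show "q (t *\<^sub>R a) / t \<le> p (a + s *\<^sub>R y) - s * p y"
          using t by (simp add: field_simps)
      qed
      thus "q (t *\<^sub>R a) \<le> t * q a" using t by (simp add: field_simps)
    qed
    moreover have "q \<le> p" using lb[of 0] by (simp add: le_fun_def)
    ultimately have "q = p" by (rule min)
    thus ?thesis using lb[of 1 x] by simp
  qed
  have add: "p (x + y) = p x + p y" for x y
    using ge sublinear_add[OF p] by (meson order_antisym)
  have neg: "p (- x) = - p x" for x
    using add[of x "- x"] sublinear_zero[OF p] by simp
  have "p (t *\<^sub>R x) = t * p x" for t x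
  proof -
    consider "t > 0" | "t = 0" | "- t > 0" by linarith
    thus ?thesis
    proof cases
      case 3
      have "p ((- t) *\<^sub>R x) = (- t) * p x" by (rule sublinear_scale[OF p 3])
      thus ?thesis using neg[of "t *\<^sub>R x"] by simp
    qed (use sublinear_scale[OF p] sublinear_zero[OF p] in auto)
  qed
  thus ?thesis by (intro linearI) (simp_all add: add)
qed

lemma hahn_banach_sublinear:
  fixes p :: "'a::real_vector \<Rightarrow> real"
  assumes "sublinear p"
  obtains L where "linear L" "\<And>x. L x \<le> p x"
  using ex_minimal_sublinear[OF assms] minimal_sublinear_imp_linear
  by (metis le_fun_def)

lemma coreE:
  assumes "core C = C" "x \<in> C"
  obtains e where "e > 0" "\<And>t. 0 \<le> t \<Longrightarrow> t \<le> e \<Longrightarrow> x + t *\<^sub>R y \<in> C"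
  using assms unfolding core_def by blast

text \<open>Let \<open>K\<close> be the cone generated by \<open>C\<close> and \<open>v0\<close> a
  point of \<open>C\<close>. The infimum \<open>q x\<close> of all \<open>s\<close> with
  \<open>s *\<^sub>R v0 - x\<close> in \<open>K\<close> is sublinear, and a linear functional below
  \<open>q\<close> is non-negative on \<open>C\<close>; openness upgrades this to
  positivity.\<close>

lemma hahn_banach_algebraically_open:
  fixes C :: "'a::real_vector set"
  assumes conv: "convex C" and opn: "core C = C" and ne: "C \<noteq> {}" and zero: "0 \<notin> C"
  obtains L :: "'a \<Rightarrow> real" where "linear L" "\<And>v. v \<in> C \<Longrightarrow> L v > 0"
proof -
  obtain v0 where v0: "v0 \<in> C" using ne by blast
  define K where "K = {t *\<^sub>R v | t v. 0 < t \<and> v \<in> C}"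
  have CK: "v \<in> K" if "v \<in> C" for v
    using that unfolding K_def by (intro CollectI exI[of _ 1] exI[of _ v]) simp
  have K_scale: "t *\<^sub>R x \<in> K" if tx: "0 < t" "x \<in> K" for t x
  proof -
    obtain s v where "0 < s" "v \<in> C" "x = s *\<^sub>R v" using tx by (auto simp: K_def)
    thus ?thesis unfolding K_def using tx(1)
      by (intro CollectI exI[of _ "t * s"] exI[of _ v]) simp
  qed
  have K_add: "x + y \<in> K" if xy: "x \<in> K" "y \<in> K" for x y
  proof -
    obtain s v t w where st: "0 < s" "v \<in> C" "x = s *\<^sub>R v" "0 < t" "w \<in> C" "y = t *\<^sub>R w"
      using xy by (auto simp: K_def)
    have "(s / (s + t)) *\<^sub>R v + (t / (s + t)) *\<^sub>R w \<in> C"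
      using st by (intro convexD[OF conv]) (auto simp flip: add_divide_distrib)
    moreover have "x + y = (s + t) *\<^sub>R ((s / (s + t)) *\<^sub>R v + (t / (s + t)) *\<^sub>R w)"
      using st by (simp add: scaleR_add_right)
    ultimately show ?thesis unfolding K_def using st
      by (intro CollectI exI[of _ "s + t"] exI[of _ "(s / (s + t)) *\<^sub>R v + (t / (s + t)) *\<^sub>R w"]) simp
  qed
  have K0: "0 \<notin> K" using zero by (auto simp: K_def)
  \<comment> \<open>Otherwise \<open>K\<close>, closed under sums and positive multiples, would
    contain 0.\<close>
  have pos: "0 < s" if "s *\<^sub>R v0 \<in> K" for s
  proof (rule ccontr)
    assume "\<not> 0 < s"
    hence "s = 0 \<or> 0 < - s" by linarith
    thus False
    proof
      assume "0 < - s"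
      from K_add[OF that K_scale[OF this CK[OF v0]]] K0 show False by simp
    qed (use that K0 in simp)
  qed
  have absorb: "\<exists>s. s *\<^sub>R v0 + x \<in> K" for x
  proof -
    obtain e where "e > 0" "\<And>t. 0 \<le> t \<Longrightarrow> t \<le> e \<Longrightarrow> v0 + t *\<^sub>R x \<in> C"
      using coreE[OF opn v0] by blast
    hence "v0 + e *\<^sub>R x \<in> C" "e > 0" by simp_all
    hence "inverse e *\<^sub>R (v0 + e *\<^sub>R x) \<in> K" by (intro K_scale CK) simp_all
    thus ?thesis using \<open>e > 0\<close> by (auto simp: scaleR_add_right)
  qed
  define S where "S = (\<lambda>x. {s. s *\<^sub>R v0 - x \<in> K})"
  define q where "q = (\<lambda>x. Inf (S x))"
  have S_ne: "S x \<noteq> {}" for x using absorb[of "- x"] by (auto simp: S_def)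
  have bdd: "bdd_below (S x)" for x
  proof -
    obtain s1 where s1: "s1 *\<^sub>R v0 + x \<in> K" using absorb by blast
    show ?thesis
    proof (rule bdd_belowI)
      fix s assume "s \<in> S x"
      hence "(s *\<^sub>R v0 - x) + (s1 *\<^sub>R v0 + x) \<in> K" using s1 by (simp only: S_def mem_Collect_eq K_add)
      hence "(s + s1) *\<^sub>R v0 \<in> K" by (simp add: algebra_simps)
      thus "- s1 \<le> s" using pos by fastforce
    qed
  qed
  have lb: "q x \<le> s" if "s *\<^sub>R v0 - x \<in> K" for s x
    unfolding q_def using that by (intro cInf_lower bdd) (auto simp: S_def)
  have gb: "c \<le> q x" if "\<And>s. s *\<^sub>R v0 - x \<in> K \<Longrightarrow> c \<le> s" for c x
    unfolding q_def using that by (intro cInf_greatest S_ne) (auto simp: S_def)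
  have "sublinear q"
  proof (rule sublinearI)
    fix x y
    have *: "q (x + y) \<le> s + t" if "s *\<^sub>R v0 - x \<in> K" "t *\<^sub>R v0 - y \<in> K" for s t
      using K_add[OF that] by (intro lb) (simp add: algebra_simps)
    have "q (x + y) - s \<le> q y" if "s *\<^sub>R v0 - x \<in> K" for s
      by (rule gb) (use *[OF that] in \<open>simp add: algebra_simps\<close>)
    hence "q (x + y) - q y \<le> q x" by (intro gb) (simp add: algebra_simps)
    thus "q (x + y) \<le> q x + q y" by simp
  next
    fix t :: real and x assume t: "0 < t"
    have "q (t *\<^sub>R x) / t \<le> q x"
    proof (rule gb)
      fix s assume "s *\<^sub>R v0 - x \<in> K"
      from K_scale[OF t this] have "q (t *\<^sub>R x) \<le> t * s"
        by (intro lb) (simp add: algebra_simps)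
      thus "q (t *\<^sub>R x) / t \<le> s" using t by (simp add: field_simps)
    qed
    thus "q (t *\<^sub>R x) \<le> t * q x" using t by (simp add: field_simps)
  qed
  then obtain L where L: "linear L" "\<And>x. L x \<le> q x" using hahn_banach_sublinear by blast
  have L_nonneg: "0 \<le> L v" if "v \<in> C" for v
    using L(2)[of "- v"] lb[of 0 "- v"] CK[OF that] linear_neg[OF L(1), of v] by simp
  \<comment> \<open>Any number strictly between -1 and 0 could replace -1/2: adding it times
    \<open>v0\<close> to \<open>v0\<close> leaves a positive multiple of \<open>v0\<close>, hence a
    point of \<open>K\<close>.\<close>
  have "L (- v0) \<le> - (1/2)"
  proof -
    have "- (1/2) *\<^sub>R v0 - - v0 = (1/2) *\<^sub>R v0"
      using scaleR_add_left[of "- (1/2)" 1 v0] by simp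
    hence "q (- v0) \<le> - (1/2)" using K_scale[of "1/2" v0] CK[OF v0] by (intro lb) simp
    thus ?thesis using L(2) order_trans by blast
  qed
  hence L0: "0 < L v0" using linear_neg[OF L(1), of v0] by simp
  \<comment> \<open>A small move from \<open>v\<close> in direction \<open>- v0\<close> stays in
    \<open>C\<close>, so \<open>L v\<close> is at least a positive multiple of
    \<open>L v0\<close>.\<close>
  have "0 < L v" if v: "v \<in> C" for v
  proof -
    obtain e where e: "e > 0" "\<And>t. 0 \<le> t \<Longrightarrow> t \<le> e \<Longrightarrow> v + t *\<^sub>R (- v0) \<in> C"
      using coreE[OF opn v] by blast
    have "0 \<le> L (v + e *\<^sub>R (- v0))" using e by (intro L_nonneg) simp
    hence "e * L v0 \<le> L v" using L(1) by (simp add: linear_diff linear_scale)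
    thus ?thesis using mult_pos_pos[OF e(1) L0] by linarith
  qed
  with L(1) show ?thesis by (rule that)
qed

section \<open>Fitzpatrick functions and representatives\<close>

text \<open>The symmetric form z . w on Z, the polar form of the quadratic form \<open>cpl\<close>;
  in particular \<open>pairing z z = 2 * cpl z\<close> and
  \<open>cpl (z - w) = cpl z + cpl w - pairing z w\<close> on Z.\<close>

definition pairing :: "'x \<times> ('x \<Rightarrow> real) \<Rightarrow> 'x \<times> ('x \<Rightarrow> real) \<Rightarrow> real" where
  "pairing p z = snd p (fst z) + snd z (fst p)"

lemma fitz_le_iff: "fitz T z \<le> ereal r \<longleftrightarrow> (\<forall>p\<in>T. pairing p z - cpl p \<le> r)"
  by (simp add: fitz_def SUP_le_iff pairing_def cpl_def)

lemma fitz_mono: "S \<subseteq> T \<Longrightarrow> fitz S z \<le> fitz T z"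
  unfolding fitz_def by (rule SUP_subset_mono) auto

lemma monotone_opD:
  assumes "monotone_op T" "p \<in> T" "q \<in> T"
  shows "pairing p q \<le> cpl p + cpl q"
  using assms unfolding monotone_op_def pairing_def cpl_def by fastforce

lemma monotone_opI:
  assumes "\<And>p q. p \<in> T \<Longrightarrow> q \<in> T \<Longrightarrow> pairing p q \<le> cpl p + cpl q"
  shows "monotone_op T"
  using assms unfolding monotone_op_def pairing_def cpl_def by fastforce

lemma fitz_le_cpl_of_monotone:
  assumes "monotone_op S" "T \<subseteq> S" "z \<in> S"
  shows "fitz T z \<le> ereal (cpl z)"
  unfolding fitz_le_iff using monotone_opD[OF assms(1) _ assms(3)] assms(2) by fastforce

lemma dual_linear: "f \<in> dual tau \<Longrightarrow> linear f"
  by (simp add: dual_def)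

lemma dual_lincomb:
  assumes "f \<in> dual tau" "h \<in> dual tau"
  shows "(\<lambda>y. s * f y + t * h y) \<in> dual tau"
proof -
  have "linear (\<lambda>y. s *\<^sub>R f y + t *\<^sub>R h y)"
    using assms by (intro linear_compose_add linear_compose_scale_right) (auto simp: dual_def)
  thus ?thesis using assms by (auto simp: dual_def intro!: continuous_intros)
qed

lemma zcomb_in_Z:
  assumes "z \<in> UNIV \<times> dual tau" "w \<in> UNIV \<times> dual tau"
  shows "zcomb t z w \<in> UNIV \<times> dual tau"
  using assms by (auto simp: zcomb_def intro!: dual_lincomb)

lemma topspace_Ztop: "lcs tau \<Longrightarrow> topspace (Ztop tau) = UNIV \<times> dual tau"
  by (auto simp: Ztop_def wstar_def lcs_def)

lemma cpl_zcomb: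
  assumes "linear (snd z)" "linear (snd w)"
  shows "cpl (zcomb t z w) = t\<^sup>2 * cpl z + t * (1 - t) * pairing z w + (1 - t)\<^sup>2 * cpl w"
  using assms
  by (simp add: cpl_def zcomb_def pairing_def linear_add linear_diff linear_scale algebra_simps power2_eq_square)

lemma pairing_zcomb:
  assumes "linear (snd p)"
  shows "pairing p (zcomb t z w) = t * pairing p z + (1 - t) * pairing p w"
  using assms by (simp add: zcomb_def pairing_def linear_add linear_diff linear_scale algebra_simps)

lemma convex_onZD:
  assumes "convex_onZ tau g" "z \<in> UNIV \<times> dual tau" "w \<in> UNIV \<times> dual tau"
    and "0 \<le> t" "t \<le> 1" "g z \<le> ereal r" "g w \<le> ereal s"
  shows "g (zcomb t z w) \<le> ereal (t * r + (1 - t) * s)"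
  using assms unfolding convex_onZ_def by blast

lemma convex_onZ_affine:
  assumes "linear (snd p)"
  shows "convex_onZ tau (\<lambda>z. ereal (pairing p z - c))"
  unfolding convex_onZ_def ereal_less_eq
proof (intro ballI allI impI)
  fix z w :: "'a \<times> ('a \<Rightarrow> real)" and r s t :: real
  assume *: "0 \<le> t \<and> t \<le> 1 \<and> pairing p z - c \<le> r \<and> pairing p w - c \<le> s"
  have "t * (pairing p z - c) + (1 - t) * (pairing p w - c) \<le> t * r + (1 - t) * s"
    using * by (intro add_mono mult_left_mono) auto
  thus "pairing p (zcomb t z w) - c \<le> t * r + (1 - t) * s"
    using assms by (simp add: pairing_zcomb algebra_simps)
qed

lemma lsc_onZ_affine:
  assumes "lcs tau" "snd p \<in> dual tau"
  shows "lsc_onZ tau (\<lambda>z. ereal (pairing p z - c))"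
proof -
  have "continuous_map (Ztop tau) euclideanreal (snd p \<circ> fst)"
    using assms unfolding Ztop_def
    by (intro continuous_map_compose[OF continuous_map_fst]) (simp add: dual_def)
  moreover have "continuous_map (wstar tau) euclideanreal (\<lambda>f. f (fst p))"
    unfolding wstar_def
    by (intro continuous_map_from_subtopology continuous_map_product_projection) simp
  hence "continuous_map (Ztop tau) euclideanreal ((\<lambda>f. f (fst p)) \<circ> snd)"
    unfolding Ztop_def by (rule continuous_map_compose[OF continuous_map_snd])
  ultimately have "continuous_map (Ztop tau) euclideanreal (\<lambda>z. pairing p z - c)"
    unfolding pairing_def comp_def by (intro continuous_intros)
  hence "closedin (Ztop tau) {z \<in> topspace (Ztop tau). pairing p z - c \<in> {..r}}" for r
    by (rule closedin_continuous_map_preimage) simp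
  thus ?thesis by (simp add: lsc_onZ_def)
qed

lemma convex_onZ_Sup:
  assumes "\<And>g. g \<in> G \<Longrightarrow> convex_onZ tau g"
  shows "convex_onZ tau (\<lambda>z. SUP g\<in>G. g z)"
  using assms unfolding convex_onZ_def SUP_le_iff by blast

lemma lsc_onZ_Sup:
  assumes "\<And>g. g \<in> G \<Longrightarrow> lsc_onZ tau g"
  shows "lsc_onZ tau (\<lambda>z. SUP g\<in>G. g z)"
\<comment> \<open>The empty supremum has the whole \<open>topspace\<close> as sublevel set, whereas
  an empty intersection would be \<open>UNIV\<close>.\<close>
proof (cases "G = {}")
  case True
  thus ?thesis by (simp add: lsc_onZ_def bot_ereal_def)
next
  case False
  hence "{z \<in> topspace (Ztop tau). (SUP g\<in>G. g z) \<le> ereal r}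
      = (\<Inter>g\<in>G. {z \<in> topspace (Ztop tau). g z \<le> ereal r})" for r
    by (auto simp: SUP_le_iff)
  thus ?thesis
    using assms False unfolding lsc_onZ_def by (auto intro!: closedin_INT)
qed

lemma fitz_eq_SUP_affine:
  "fitz T = (\<lambda>z. SUP g\<in>(\<lambda>p z. ereal (pairing p z - cpl p)) ` T. g z)"
  by (simp add: fitz_def pairing_def cpl_def image_image fun_eq_iff)

lemma convex_onZ_fitz:
  assumes "T \<subseteq> UNIV \<times> dual tau"
  shows "convex_onZ tau (fitz T)"
  unfolding fitz_eq_SUP_affine using assms
  by (intro convex_onZ_Sup) (auto intro!: convex_onZ_affine dual_linear)

lemma lsc_onZ_fitz:
  assumes "lcs tau" "T \<subseteq> UNIV \<times> dual tau"
  shows "lsc_onZ tau (fitz T)"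
  unfolding fitz_eq_SUP_affine using assms
  by (intro lsc_onZ_Sup) (auto intro!: lsc_onZ_affine)

section \<open>The hull \<open>psi\<close> and its comparison with \<open>fitz\<close> and
  \<open>cpl\<close>\<close>

lemma psi_eq_SUP:
  "psi tau T = (\<lambda>z. SUP g\<in>{g. convex_onZ tau g \<and> lsc_onZ tau g \<and>
      (\<forall>w\<in>UNIV \<times> dual tau. g w \<le> cind T w)}. g z)"
  by (auto simp: psi_def fun_eq_iff intro!: arg_cong[of _ _ Sup])

lemma convex_onZ_psi: "convex_onZ tau (psi tau T)"
  unfolding psi_eq_SUP by (rule convex_onZ_Sup) simp

lemma lsc_onZ_psi: "lsc_onZ tau (psi tau T)"
  unfolding psi_eq_SUP by (rule lsc_onZ_Sup) simp

lemma le_psi: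
  assumes "convex_onZ tau g" "lsc_onZ tau g"
    and "\<And>w. w \<in> T \<Longrightarrow> g w \<le> ereal (cpl w)"
  shows "g z \<le> psi tau T z"
  unfolding psi_eq_SUP using assms by (intro SUP_upper) (auto simp: cind_def)

lemma psi_le_cpl:
  assumes "T \<subseteq> UNIV \<times> dual tau" "z \<in> T"
  shows "psi tau T z \<le> ereal (cpl z)"
proof -
  have "cind T z = ereal (cpl z)" "z \<in> UNIV \<times> dual tau" using assms by (auto simp: cind_def)
  thus ?thesis unfolding psi_eq_SUP by (metis (mono_tags, lifting) SUP_least mem_Collect_eq)
qed

text \<open>\<open>psi tau T\<close> itself competes in the supremum defining
  \<open>psi tau S\<close>.\<close>

lemma psi_antimono:
  assumes "S \<subseteq> T" "T \<subseteq> UNIV \<times> dual tau"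
  shows "psi tau T z \<le> psi tau S z"
  using assms psi_le_cpl by (intro le_psi convex_onZ_psi lsc_onZ_psi) blast

lemma fitz_le_psi:
  assumes "lcs tau" "T \<subseteq> UNIV \<times> dual tau" "monotone_op T"
  shows "fitz T z \<le> psi tau T z"
  using assms by (intro le_psi convex_onZ_fitz lsc_onZ_fitz fitz_le_cpl_of_monotone[of T]) auto

lemma pairing_commute: "pairing p z = pairing z p"
  by (simp add: pairing_def)

text \<open>The bound on \<open>fitz T w\<close> says exactly that the affine function
  \<open>pairing w p - r\<close> of \<open>p\<close> lies below \<open>cpl\<close> on
  \<open>T\<close>.\<close>

lemma fenchel_fitz_psi:
  assumes "lcs tau" "w \<in> UNIV \<times> dual tau" "fitz T w \<le> ereal r"
  shows "ereal (pairing w z - r) \<le> psi tau T z"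
proof (rule le_psi)
  show "ereal (pairing w p - r) \<le> ereal (cpl p)" if "p \<in> T" for p
    using assms(3) that by (auto simp: fitz_le_iff pairing_commute[of w p])
qed (use assms in \<open>auto intro!: convex_onZ_affine lsc_onZ_affine dual_linear\<close>)

text \<open>Fenchel's inequality at the diagonal gives \<open>\<psi>(z) + \<phi>(z) \<ge> 2 c(z)\<close>, and
  \<open>\<phi> \<le> \<psi>\<close>.\<close>
lemma cpl_le_psi:
  assumes "lcs tau" "T \<subseteq> UNIV \<times> dual tau" "monotone_op T" "z \<in> UNIV \<times> dual tau"
  shows "ereal (cpl z) \<le> psi tau T z"
proof (rule ccontr)
  assume "\<not> ?thesis"
  hence lt: "psi tau T z < ereal (cpl z)" by simp
  hence "fitz T z \<le> ereal (cpl z)"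
    using fitz_le_psi[OF assms(1-3)] by (meson order_trans order_less_imp_le)
  from fenchel_fitz_psi[OF assms(1,4) this, of z] lt show False
    by (simp add: pairing_def cpl_def)
qed

text \<open>Evaluate \<open>h \<ge> c\<close> at the midpoint of two points where \<open>h = c\<close>.\<close>
lemma monotone_op_representative:
  assumes "convex_onZ tau h" "\<And>z. z \<in> UNIV \<times> dual tau \<Longrightarrow> ereal (cpl z) \<le> h z"
    and "S \<subseteq> UNIV \<times> dual tau" "\<And>z. z \<in> S \<Longrightarrow> h z = ereal (cpl z)"
  shows "monotone_op S"
proof (rule monotone_opI)
  fix p q assume pq: "p \<in> S" "q \<in> S"
  hence Z: "p \<in> UNIV \<times> dual tau" "q \<in> UNIV \<times> dual tau" using assms(3) by auto
  hence lin: "linear (snd p)" "linear (snd q)" by (auto intro: dual_linear)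
  have "zcomb (1/2) p q \<in> UNIV \<times> dual tau"
    by (rule zcomb_in_Z[OF Z])
  hence "ereal (cpl (zcomb (1/2) p q)) \<le> h (zcomb (1/2) p q)" by (rule assms(2))
  also have "\<dots> \<le> ereal (1/2 * cpl p + (1 - 1/2) * cpl q)"
    by (rule convex_onZD[OF assms(1) Z]) (simp_all add: assms(4) pq)
  finally show "pairing p q \<le> cpl p + cpl q"
    by (simp add: cpl_zcomb[OF lin] power2_eq_square)
qed

text \<open>At \<open>zcomb t w z\<close> with small \<open>t\<close>, \<open>fitz\<close> is at
  least \<open>cpl\<close> by NI and at most \<open>t * s + (1 - t) * cpl z\<close> by convexity.
  The terms without a factor \<open>t\<close> cancel; divide by \<open>t\<close> and let it tend to
  0.\<close>

lemma V_NI_subgradient: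
  assumes T: "T \<subseteq> UNIV \<times> dual tau" and V: "core V = V" and NI: "V_NI tau T V"
    and z: "z \<in> V \<times> dual tau" "fitz (restr T V) z \<le> ereal (cpl z)"
    and w: "w \<in> UNIV \<times> dual tau" "fitz (restr T V) w \<le> ereal s"
  shows "pairing z w \<le> cpl z + s"
proof -
  have "fst z \<in> V" using z(1) by auto
  then obtain e0 where e0: "e0 > 0"
      "\<And>t. 0 \<le> t \<Longrightarrow> t \<le> e0 \<Longrightarrow> fst z + t *\<^sub>R (fst w - fst z) \<in> V"
    using coreE[OF V] by blast
  define e where "e = min e0 1"
  have lin: "linear (snd z)" "linear (snd w)" using z w by (auto intro: dual_linear)
  have cvx: "convex_onZ tau (fitz (restr T V))"
    using T by (intro convex_onZ_fitz) (auto simp: restr_def)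
  have "t * cpl w + (1 - t) * pairing z w - (1 - t) * cpl z \<le> s" if t: "0 < t" "t \<le> e" for t
  proof -
    have "zcomb t w z \<in> V \<times> dual tau"
    proof -
      have "t *\<^sub>R fst w + (1 - t) *\<^sub>R fst z \<in> V"
        using e0(2)[of t] t by (simp add: e_def algebra_simps)
      moreover have "zcomb t w z \<in> UNIV \<times> dual tau" using z w by (intro zcomb_in_Z) auto
      ultimately show ?thesis by (simp add: zcomb_def)
    qed
    hence "ereal (cpl (zcomb t w z)) \<le> fitz (restr T V) (zcomb t w z)"
      using NI by (auto simp: V_NI_def)
    also have "\<dots> \<le> ereal (t * s + (1 - t) * cpl z)"
      using z w t by (intro convex_onZD[OF cvx]) (auto simp: e_def)
    finally have "t * (t * cpl w + (1 - t) * pairing z w - (1 - t) * cpl z) \<le> t * s"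
      by (simp add: cpl_zcomb lin pairing_commute[of w z] algebra_simps power2_eq_square)
    thus ?thesis using t by simp
  qed
  hence "eventually (\<lambda>t. t * cpl w + (1 - t) * pairing z w - (1 - t) * cpl z \<le> s) (at_right 0)"
    using e0 by (intro eventually_at_rightI[of 0 e]) (auto simp: e_def)
  moreover have "((\<lambda>t. t * cpl w + (1 - t) * pairing z w - (1 - t) * cpl z)
      \<longlongrightarrow> 0 * cpl w + (1 - 0) * pairing z w - (1 - 0) * cpl z) (at_right 0)"
    by (intro tendsto_intros)
  ultimately have "0 * cpl w + (1 - 0) * pairing z w - (1 - 0) * cpl z \<le> s"
    by (intro tendsto_upperbound) auto
  thus ?thesis by simp
qed

section \<open>Separation from closed convex epigraphs\<close>

lemma sum_fun_apply: "(\<Sum>i\<in>F. g i) x = (\<Sum>i\<in>F. g i x)"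
  by (induction F rule: infinite_finite_induct) simp_all

text \<open>Phrasing openness through the filter \<open>at_right 0\<close> lets finitely many
  conditions be combined without choosing radii; \<open>b / 2\<close> turns the half-open range of
  \<open>t\<close> into a closed one.\<close>

lemma core_eqI:
  assumes "\<And>x y. x \<in> C \<Longrightarrow> eventually (\<lambda>t. x + t *\<^sub>R y \<in> C) (at_right 0)"
  shows "core C = C"
proof -
  have "\<exists>e>0. \<forall>t. 0 \<le> t \<and> t \<le> e \<longrightarrow> x + t *\<^sub>R y \<in> C" if x: "x \<in> C" for x y
  proof -
    obtain b where b: "b > 0" "\<And>t. 0 < t \<Longrightarrow> t < b \<Longrightarrow> x + t *\<^sub>R y \<in> C"
      using assms[OF x, of y] by (auto simp: eventually_at_right_field)
    have "x + t *\<^sub>R y \<in> C" if "0 \<le> t" "t \<le> b / 2" for t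
      using b x that by (cases "t = 0") auto
    thus ?thesis using b(1) by (intro exI[of _ "b / 2"]) auto
  qed
  thus ?thesis by (auto simp: core_def)
qed

lemma core_eq_eventually:
  assumes "core C = C" "x \<in> C"
  shows "eventually (\<lambda>t. x + t *\<^sub>R y \<in> C) (at_right 0)"
proof -
  obtain e where "e > 0" "\<And>t. 0 \<le> t \<Longrightarrow> t \<le> e \<Longrightarrow> x + t *\<^sub>R y \<in> C"
    using coreE[OF assms] by blast
  thus ?thesis by (intro eventually_at_rightI[of 0 e]) auto
qed

lemma core_Times:
  assumes "core A = A" "core B = B"
  shows "core (A \<times> B) = A \<times> B"
proof (rule core_eqI)
  fix x y assume "x \<in> A \<times> B"
  hence "fst x \<in> A" "snd x \<in> B" by auto
  from core_eq_eventually[OF assms(1) this(1), of "fst y"]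
    core_eq_eventually[OF assms(2) this(2), of "snd y"]
  show "eventually (\<lambda>t. x + t *\<^sub>R y \<in> A \<times> B) (at_right 0)"
    by eventually_elim (simp add: mem_Times_iff)
qed

text \<open>Openness of \<open>U\<close> suffices: a move of \<open>x - u\<close> along
  \<open>y\<close> is a move of \<open>u\<close> along \<open>- y\<close>. The set has the form used
  by \<open>convex_differences\<close>.\<close>

lemma core_differences:
  assumes "core U = U"
  shows "core (\<Union>x\<in>E. \<Union>u\<in>U. {x - u}) = (\<Union>x\<in>E. \<Union>u\<in>U. {x - u})"
proof (rule core_eqI)
  fix m y assume "m \<in> (\<Union>x\<in>E. \<Union>u\<in>U. {x - u})"
  then obtain x u where xu: "x \<in> E" "u \<in> U" "m = x - u" by blast
  from core_eq_eventually[OF assms xu(2), of "- y"]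
  show "eventually (\<lambda>t. m + t *\<^sub>R y \<in> (\<Union>x\<in>E. \<Union>u\<in>U. {x - u})) (at_right 0)"
  proof eventually_elim
    case (elim t)
    moreover have "m + t *\<^sub>R y = x - (u + t *\<^sub>R (- y))" by (simp add: xu)
    ultimately show ?case using xu(1) by blast
  qed
qed

section \<open>Neighbourhoods and continuous functionals\<close>

lemma lcs_continuous_affine:
  assumes "lcs tau"
  shows "continuous_map tau tau (\<lambda>y. s *\<^sub>R y + x)"
proof -
  have "continuous_map tau tau ((\<lambda>(a, x). a *\<^sub>R x) \<circ> (\<lambda>y. (s, y)))"
    using assms by (intro continuous_map_compose[OF continuous_map_pairedI]) (auto simp: lcs_def)
  hence "continuous_map tau tau ((\<lambda>(x, y). x + y) \<circ> (\<lambda>y. (s *\<^sub>R y, x)))"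
    using assms by (intro continuous_map_compose[OF continuous_map_pairedI])
      (auto simp: lcs_def comp_def)
  thus ?thesis by (simp add: comp_def)
qed

lemma lcs_openin_affine_vimage:
  assumes "lcs tau" "openin tau W"
  shows "openin tau {y. s *\<^sub>R y + x \<in> W}"
  using openin_continuous_map_preimage[OF lcs_continuous_affine[OF assms(1)] assms(2)] assms(1)
  by (simp add: lcs_def)

lemma lcs_openin_core:
  assumes "lcs tau" "openin tau W"
  shows "core W = W"
proof (rule core_eqI)
  fix x y assume x: "x \<in> W"
  have "continuous_map euclideanreal tau ((\<lambda>(a, x). a *\<^sub>R x) \<circ> (\<lambda>t. (t, y)))"
    using assms(1) by (intro continuous_map_compose[OF continuous_map_pairedI])
      (auto simp: lcs_def)
  hence "continuous_map euclideanreal tau ((\<lambda>(x, y). x + y) \<circ> (\<lambda>t. (x, t *\<^sub>R y)))"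
    using assms(1) by (intro continuous_map_compose[OF continuous_map_pairedI])
      (auto simp: lcs_def comp_def)
  from openin_continuous_map_preimage[OF this assms(2)]
  have "open {t. x + t *\<^sub>R y \<in> W}" by (simp add: comp_def)
  hence "eventually (\<lambda>t. t \<in> {t. x + t *\<^sub>R y \<in> W}) (nhds 0)"
    using x by (intro eventually_nhds_in_open) auto
  thus "eventually (\<lambda>t. x + t *\<^sub>R y \<in> W) (at_right 0)"
    using filter_leD[OF at_within_le_nhds] by auto
qed

lemma bounded_above_imp_in_dual:
  assumes lcs: "lcs tau" and a: "linear a" and W: "openin tau W" "0 \<in> W"
    and bd: "\<And>w. w \<in> W \<Longrightarrow> a w \<le> K"
  shows "a \<in> dual tau"
proof -
  have "openin tau {x. a x \<in> U}" if U: "open U" for U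
  proof (subst openin_subopen, intro ballI)
    fix x assume "x \<in> {x. a x \<in> U}"
    then obtain d where d: "d > 0" "ball (a x) d \<subseteq> U" using U by (auto simp: open_contains_ball)
    \<comment> \<open>Chosen so that \<open>K < s * d\<close>.\<close>
    define s where "s = (\<bar>K\<bar> + 1) / d"
    have s: "s > 0" using d by (simp add: s_def)
    \<comment> \<open>\<open>W\<close> need not be symmetric, so both signs of the scaled difference
      are placed in it; this bounds \<open>a\<close> of the difference in absolute value.\<close>
    define N where "N = {y. s *\<^sub>R y + (- s) *\<^sub>R x \<in> W} \<inter> {y. (- s) *\<^sub>R y + s *\<^sub>R x \<in> W}"
    have "openin tau N" unfolding N_def using lcs W by (intro openin_Int lcs_openin_affine_vimage)
    moreover have "x \<in> N" using W by (simp add: N_def)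
    moreover have "N \<subseteq> {x. a x \<in> U}"
    proof
      fix y assume "y \<in> N"
      hence "a (s *\<^sub>R y + (- s) *\<^sub>R x) \<le> K" "a ((- s) *\<^sub>R y + s *\<^sub>R x) \<le> K"
        by (auto simp: N_def intro!: bd)
      hence "s * \<bar>a x - a y\<bar> \<le> K"
        using a s by (auto simp: linear_add linear_diff linear_neg linear_scale abs_if algebra_simps)
      also have "K < s * d" using d by (simp add: s_def)
      finally have "a y \<in> ball (a x) d" using s by (simp add: dist_real_def)
      thus "y \<in> {x. a x \<in> U}" using d by auto
    qed
    ultimately show "\<exists>N. openin tau N \<and> x \<in> N \<and> N \<subseteq> {x. a x \<in> U}" by blast
  qed
  thus ?thesis using a lcs by (simp add: dual_def continuous_map_def lcs_def)
qed

lemma wstar_nbhd: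
  assumes B: "openin (wstar tau) B" "f0 \<in> B"
  obtains F e where "finite F" "e > (0::real)"
    "\<And>f. f \<in> dual tau \<Longrightarrow> (\<And>i. i \<in> F \<Longrightarrow> \<bar>f i - f0 i\<bar> < e) \<Longrightarrow> f \<in> B"
proof -
  obtain B' where B': "openin (powertop_real UNIV) B'" "B = B' \<inter> dual tau"
    using B by (auto simp: wstar_def openin_subtopology)
  obtain X where X: "f0 \<in> (\<Pi>\<^sub>E i\<in>UNIV. X i)" "\<And>i. openin euclideanreal (X i)"
      "finite {i. X i \<noteq> topspace euclideanreal}" "(\<Pi>\<^sub>E i\<in>UNIV. X i) \<subseteq> B'"
    using product_topology_open_contains_basis[OF B'(1), of f0] B B' by auto
  define F where "F = {i. X i \<noteq> UNIV}"
  have fin: "finite F" using X(3) by (simp add: F_def)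
  have "\<exists>d>0. ball (f0 i) d \<subseteq> X i" for i
    using X(1) X(2)[of i] by (auto simp: open_contains_ball PiE_iff)
  then obtain d where d: "\<And>i. d i > 0" "\<And>i. ball (f0 i) (d i) \<subseteq> X i" by metis
  \<comment> \<open>The inserted 1 keeps the minimum meaningful when \<open>F\<close> is
    empty.\<close>
  define e where "e = Min (insert 1 (d ` F))"
  have "e > 0" using fin d by (simp add: e_def)
  moreover have "f \<in> B" if f: "f \<in> dual tau" "\<And>i. i \<in> F \<Longrightarrow> \<bar>f i - f0 i\<bar> < e" for f
  proof -
    have "f i \<in> X i" for i
    proof (cases "i \<in> F")
      case True
      hence "e \<le> d i" using fin by (simp add: e_def)
      hence "f i \<in> ball (f0 i) (d i)" using f(2)[OF True] by (simp add: dist_real_def)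
      thus ?thesis using d by blast
    qed (simp add: F_def)
    thus ?thesis using X(4) f(1) B'(2) by (auto simp: PiE_iff)
  qed
  ultimately show ?thesis using that fin by blast
qed

text \<open>The dual of \<open>\<real>\<^sup>X\<close> consists of the finite combinations of evaluations, and on linear
  functions such a combination is the evaluation at a single point.\<close>
lemma finitely_bounded_functional_eq_evaluation:
  fixes b :: "('x::real_vector \<Rightarrow> real) \<Rightarrow> real"
  assumes b: "linear b" and F: "finite F" and e: "e > 0"
    and bd: "\<And>h. (\<And>i. i \<in> F \<Longrightarrow> \<bar>h i\<bar> < e) \<Longrightarrow> b h \<le> K"
  obtains u where "\<And>f. linear f \<Longrightarrow> b f = f u"
proof -
  have zero: "b h = 0" if h: "\<And>i. i \<in> F \<Longrightarrow> h i = 0" for h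
  proof (rule ccontr)
    assume nz: "b h \<noteq> 0"
    \<comment> \<open>Every multiple of \<open>h\<close> also vanishes on \<open>F\<close>; this one
      has \<open>b\<close>-value above \<open>K\<close>.\<close>
    have "b (((\<bar>K\<bar> + 1) / b h) *\<^sub>R h) \<le> K" using h e by (intro bd) simp
    thus False using nz b by (simp add: linear_scale)
  qed
  \<comment> \<open>The coordinate vectors: subtracting their combination with coefficients
    \<open>f i\<close> makes \<open>f\<close> vanish on \<open>F\<close>.\<close>
  define D where "D = (\<lambda>(i::'x) x. if x = i then 1 else 0 :: real)"
  define u where "u = (\<Sum>i\<in>F. b (D i) *\<^sub>R i)"
  have "b f = f u" if f: "linear f" for f
  proof -
    have "b (f - (\<Sum>i\<in>F. f i *\<^sub>R D i)) = 0"
      using F by (intro zero) (simp add: sum_fun_apply D_def if_distrib sum.delta cong: if_cong)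
    hence "b f = (\<Sum>i\<in>F. f i * b (D i))"
      using b by (simp add: linear_diff linear_sum linear_scale)
    also have "\<dots> = f u"
      using f by (simp add: u_def linear_sum linear_scale mult.commute)
    finally show ?thesis .
  qed
  thus ?thesis by (rule that)
qed

text \<open>An algebraically open convex box \<open>U\<close> around the point
  \<open>(z0, c0)\<close> misses the epigraph \<open>E\<close>, so a linear \<open>L\<close> is
  positive on the differences \<open>E - U\<close>. Boundedness on the three factors of the box
  identifies \<open>L\<close>: an element \<open>a\<close> of the dual, evaluation at
  \<open>u\<close>, and a coefficient \<open>l \<ge> 0\<close>.\<close>

lemma separation_epigraph:
  assumes lcs: "lcs tau" and cvx: "convex_onZ tau g" and lsc: "lsc_onZ tau g"
    and z0: "z0 \<in> UNIV \<times> dual tau" "ereal c0 < g z0"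
    and w0: "w0 \<in> UNIV \<times> dual tau" "g w0 \<le> ereal s0"
  obtains a u l e where "a \<in> dual tau" "0 \<le> l" "0 < e"
    "\<And>z s. z \<in> UNIV \<times> dual tau \<Longrightarrow> g z \<le> ereal s
      \<Longrightarrow> e \<le> pairing (u, a) z - pairing (u, a) z0 + l * (s - c0)"
proof -
  obtain x0 f0 where zz: "z0 = (x0, f0)" by force
  have f0: "f0 \<in> dual tau" using z0 zz by simp
  \<comment> \<open>The spare room below \<open>g z0\<close> is what makes the box contain
    \<open>c0\<close> in its last factor while \<open>g\<close> exceeds \<open>r\<close> near
    \<open>z0\<close>.\<close>
  obtain r where r: "c0 < r" "ereal r < g z0" using ereal_dense2[OF z0(2)] by auto
  have "openin (Ztop tau) (topspace (Ztop tau) - {z \<in> topspace (Ztop tau). g z \<le> ereal r})"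
    using lsc by (auto simp: lsc_onZ_def)
  moreover have "z0 \<in> topspace (Ztop tau) - {z \<in> topspace (Ztop tau). g z \<le> ereal r}"
    using z0 r lcs by (simp add: topspace_Ztop)
  ultimately obtain A B where AB: "openin tau A" "openin (wstar tau) B" "x0 \<in> A" "f0 \<in> B"
      "A \<times> B \<subseteq> topspace (Ztop tau) - {z \<in> topspace (Ztop tau). g z \<le> ereal r}"
    unfolding zz Ztop_def openin_prod_topology_alt by meson
  obtain F e0 where Fe: "finite F" "e0 > (0::real)"
      "\<And>f. f \<in> dual tau \<Longrightarrow> (\<And>i. i \<in> F \<Longrightarrow> \<bar>f i - f0 i\<bar> < e0) \<Longrightarrow> f \<in> B"
    using wstar_nbhd[OF AB(2,4)] by metis
  have "openin tau {y. 1 *\<^sub>R y + x0 \<in> A}" by (rule lcs_openin_affine_vimage[OF lcs AB(1)])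
  moreover have "0 \<in> {y. 1 *\<^sub>R y + x0 \<in> A}" using AB by simp
  ultimately obtain W where W: "openin tau W" "convex W" "0 \<in> W" "W \<subseteq> {y. 1 *\<^sub>R y + x0 \<in> A}"
    using lcs unfolding lcs_def by meson
  define A' where "A' = {y. 1 *\<^sub>R y + (- x0) \<in> W}"
  have A'_eq: "A' = (+) x0 ` W"
    by (force simp: A'_def image_iff algebra_simps)
  \<comment> \<open>A box in the space of all functions, not only in the dual; points of
    \<open>E\<close> have their functional in the dual, so those in \<open>H\<close> fall into
    \<open>B\<close>.\<close>
  define H where "H = {h. \<forall>i\<in>F. \<bar>h i - f0 i\<bar> < e0}"
  define U where "U = A' \<times> H \<times> {..<r}"
  define E where "E = {(x, f, s). f \<in> dual tau \<and> g (x, f) \<le> ereal s}"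
  define M where "M = (\<Union>x\<in>E. \<Union>u\<in>U. {x - u})"
  have coreU: "core U = U"
    unfolding U_def
  proof (intro core_Times)
    show "core A' = A'"
      unfolding A'_def by (rule lcs_openin_core[OF lcs lcs_openin_affine_vimage[OF lcs W(1)]])
    show "core H = H"
    proof (rule core_eqI)
      fix h y assume h: "h \<in> H"
      have "eventually (\<lambda>t. \<bar>h i + t * y i - f0 i\<bar> < e0) (at_right 0)" if "i \<in> F" for i
      proof (rule order_tendstoD(2))
        show "((\<lambda>t. \<bar>h i + t * y i - f0 i\<bar>) \<longlongrightarrow> \<bar>h i + 0 * y i - f0 i\<bar>) (at_right 0)"
          by (intro tendsto_intros)
      qed (use h that in \<open>simp add: H_def\<close>)
      thus "eventually (\<lambda>t. h + t *\<^sub>R y \<in> H) (at_right 0)"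
        using Fe(1) by (simp add: H_def eventually_ball_finite)
    qed
    show "core {..<r} = {..<r}"
    proof (rule core_eqI)
      fix x y assume "x \<in> {..<r}"
      moreover have "((\<lambda>t. x + t *\<^sub>R y) \<longlongrightarrow> x + 0 *\<^sub>R y) (at_right 0)"
        by (intro tendsto_intros)
      ultimately show "eventually (\<lambda>t. x + t *\<^sub>R y \<in> {..<r}) (at_right 0)"
        using order_tendstoD(2) by fastforce
    qed
  qed
  have convU: "convex U"
    unfolding U_def
  proof (intro convex_Times)
    show "convex A'" using W(2) by (simp add: A'_eq convex_translation)
    have "H = (\<Inter>i\<in>F. (\<lambda>h. h i) -` ball (f0 i) e0)"
      by (auto simp: H_def dist_real_def abs_minus_commute)
    moreover have "convex ((\<lambda>h. h i) -` ball (f0 i) e0)" for i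
      by (intro convex_linear_vimage linearI) simp_all
    ultimately show "convex H" by (simp add: convex_INT)
  qed simp
  have convE: "convex E"
    unfolding convex_alt
  proof (intro ballI allI impI)
    fix p q and t :: real assume pq: "p \<in> E" "q \<in> E" and t: "0 \<le> t \<and> t \<le> 1"
    obtain x f s y h s' where eq: "p = (x, f, s)" "q = (y, h, s')" by (metis prod_cases3)
    have "g (zcomb (1 - t) (x, f) (y, h)) \<le> ereal ((1 - t) * s + (1 - (1 - t)) * s')"
      using pq t by (intro convex_onZD[OF cvx]) (simp_all add: E_def eq)
    moreover have "(1 - t) *\<^sub>R f + t *\<^sub>R h = (\<lambda>y. (1 - t) * f y + t * h y)"
      by (simp add: fun_eq_iff)
    moreover have "(\<lambda>y. (1 - t) * f y + t * h y) \<in> dual tau"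
      using pq by (intro dual_lincomb) (auto simp: E_def eq)
    ultimately show "(1 - t) *\<^sub>R p + t *\<^sub>R q \<in> E"
      by (simp add: E_def eq zcomb_def)
  qed
  have "0 \<notin> M"
  proof
    assume "0 \<in> M"
    then obtain p where "p \<in> E" "p \<in> U" by (auto simp: M_def)
    then obtain x f s where p: "f \<in> dual tau" "g (x, f) \<le> ereal s" "x \<in> A'" "f \<in> H" "s < r"
      by (auto simp: E_def U_def)
    have "x \<in> A" using p(3) W(4) by (auto simp: A'_def)
    moreover have "f \<in> B" using p(1,4) by (intro Fe(3)) (auto simp: H_def)
    ultimately have "\<not> g (x, f) \<le> ereal r" using AB(5) by blast
    thus False using p(2,5) by (meson ereal_less_eq(3) less_imp_le order_trans)
  qed
  define base where "base = (x0, f0, c0)"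
  define p0 where "p0 = (fst w0, snd w0, s0)"
  have base: "base \<in> U" using W(3) Fe(2) r by (simp add: base_def U_def A'_def H_def)
  have p0: "p0 \<in> E" using w0 by (auto simp: p0_def E_def)
  have "M \<noteq> {}" using base p0 unfolding M_def by blast
  moreover have "convex M" unfolding M_def using convE convU by (rule convex_differences)
  moreover have "core M = M" unfolding M_def by (rule core_differences[OF coreU])
  ultimately obtain L where L: "linear L" "\<And>m. m \<in> M \<Longrightarrow> L m > (0::real)"
    using hahn_banach_algebraically_open[of M] \<open>0 \<notin> M\<close> by blast
  have sep: "L q < L p" if "p \<in> E" "q \<in> U" for p q
    using L(2)[of "p - q"] that linear_diff[OF L(1), of p q] by (auto simp: M_def)
  define a where "a = (\<lambda>x. L (x, 0, 0))"
  define b where "b = (\<lambda>h. L (0, h, 0))"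
  define l where "l = L (0, 0, 1)"
  have "linear (L \<circ> (\<lambda>x. (x, 0, 0)))" "linear (L \<circ> (\<lambda>h. (0, h, 0)))"
    by (intro linear_compose L(1) linearI; simp)+
  hence a: "linear a" and b: "linear b" by (simp_all add: a_def b_def comp_def)
  have L_eq: "L (x, h, t) = a x + b h + l * t" for x h t
  proof -
    have "(x, h, t) = (x, 0, 0) + ((0, h, 0) + t *\<^sub>R (0, 0, 1))" by simp
    thus ?thesis unfolding a_def b_def l_def
      by (simp only: linear_add[OF L(1)] linear_scale[OF L(1)]) simp
  qed
  \<comment> \<open>Since \<open>L\<close> on \<open>U\<close> stays below \<open>L p0\<close>, this
    bounds every increment of \<open>L\<close> from \<open>base\<close> inside
    \<open>U\<close>.\<close>
  define K where "K = L p0 - L base"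
  have a_dual: "a \<in> dual tau"
  proof (rule bounded_above_imp_in_dual[OF lcs a W(1,3)])
    fix w assume "w \<in> W"
    hence "(x0 + w, f0, c0) \<in> U" using base by (auto simp: U_def base_def A'_eq)
    from sep[OF p0 this] show "a w \<le> K"
      using a by (simp add: K_def base_def L_eq linear_add)
  qed
  have "b h \<le> K" if h: "\<And>i. i \<in> F \<Longrightarrow> \<bar>h i\<bar> < e0" for h
  proof -
    have "(x0, f0 + h, c0) \<in> U" using base h by (auto simp: U_def base_def H_def)
    from sep[OF p0 this] show ?thesis
      using b by (simp add: K_def base_def L_eq linear_add)
  qed
  then obtain u where u: "\<And>f. linear f \<Longrightarrow> b f = f u"
    using finitely_bounded_functional_eq_evaluation[OF b Fe(1,2)] by metis
  \<comment> \<open>The last factor of \<open>U\<close> is unbounded below, so a negative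
    \<open>l\<close> would make \<open>L\<close> unbounded above on \<open>U\<close>.\<close>
  have "0 \<le> l"
  proof (rule ccontr)
    assume l: "\<not> 0 \<le> l"
    define n where "n = (\<bar>K\<bar> + 1) / (- l)"
    have "n > 0" using l unfolding n_def by (intro divide_pos_pos) auto
    hence "(x0, f0, c0 - n) \<in> U" using base by (auto simp: U_def base_def)
    from sep[OF p0 this] have "- (l * n) < K"
      by (simp add: K_def base_def L_eq algebra_simps)
    thus False using l by (simp add: n_def)
  qed
  \<comment> \<open>A point of \<open>U\<close> slightly towards \<open>p0\<close> has a larger
    \<open>L\<close>-value than \<open>base\<close>; the difference is the uniform gap
    \<open>e\<close>.\<close>
  obtain q where q: "q \<in> U" "L base < L q"
  proof -
    have m: "0 < L (p0 - base)" using sep[OF p0 base] by (simp add: linear_diff[OF L(1)])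
    obtain t where t: "t > 0" "\<And>s. 0 \<le> s \<Longrightarrow> s \<le> t \<Longrightarrow> base + s *\<^sub>R (p0 - base) \<in> U"
      using coreE[OF coreU base] by blast
    have "L base < L (base + t *\<^sub>R (p0 - base))"
      using t(1) m by (simp add: linear_add[OF L(1)] linear_scale[OF L(1)])
    thus ?thesis using that t by (meson less_imp_le order_refl)
  qed
  show ?thesis
  proof (rule that[OF a_dual \<open>0 \<le> l\<close>])
    show "0 < L q - L base" using q by simp
    fix z s assume z: "z \<in> UNIV \<times> dual tau" "g z \<le> ereal s"
    have "(fst z, snd z, s) \<in> E" using z by (auto simp: E_def)
    from sep[OF this q(1)] have "L q < a (fst z) + b (snd z) + l * s" by (simp add: L_eq)
    moreover have "b (snd z) = snd z u" "b f0 = f0 u"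
      using z f0 by (auto intro!: u dual_linear)
    ultimately show "L q - L base \<le> pairing (u, a) z - pairing (u, a) z0 + l * (s - c0)"
      by (simp add: base_def L_eq pairing_def zz algebra_simps)
  qed
qed

text \<open>If a convex lsc minorant \<open>g\<close> exceeded \<open>c\<close> at \<open>z\<close>, a separating functional \<open>w\<^sub>1\<close> would exist;
  averaging it with \<open>z\<close> with weights that also cover a vertical hyperplane (\<open>l = 0\<close>) yields a
  point violating the subgradient inequality.\<close>
lemma psi_le_cpl_of_subgradient:
  assumes lcs: "lcs tau" and A: "A \<subseteq> UNIV \<times> dual tau" "A \<noteq> {}"
    and z: "z \<in> UNIV \<times> dual tau" "fitz A z \<le> ereal (cpl z)"
    and sub: "\<And>w s. w \<in> UNIV \<times> dual tau \<Longrightarrow> fitz A w \<le> ereal s \<Longrightarrow> pairing z w \<le> cpl z + s"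
  shows "psi tau A z \<le> ereal (cpl z)"
  unfolding psi_eq_SUP
proof (rule SUP_least, rule ccontr)
  fix g assume "g \<in> {g. convex_onZ tau g \<and> lsc_onZ tau g \<and> (\<forall>w\<in>UNIV \<times> dual tau. g w \<le> cind A w)}"
    and "\<not> g z \<le> ereal (cpl z)"
  hence g: "convex_onZ tau g" "lsc_onZ tau g" "ereal (cpl z) < g z"
    and le: "\<And>p. p \<in> UNIV \<times> dual tau \<Longrightarrow> g p \<le> cind A p"
    by auto
  have gA: "g p \<le> ereal (cpl p)" if "p \<in> A" for p
    using le[of p] A that by (auto simp: cind_def)
  obtain p0 where "p0 \<in> A" using A by blast
  hence p0: "p0 \<in> UNIV \<times> dual tau" "g p0 \<le> ereal (cpl p0)" using A gA by auto
  obtain a u l e where sep: "a \<in> dual tau" "0 \<le> l" "0 < e"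
    "\<And>p s. p \<in> UNIV \<times> dual tau \<Longrightarrow> g p \<le> ereal s
      \<Longrightarrow> e \<le> pairing (u, a) p - pairing (u, a) z + l * (s - cpl z)"
    using separation_epigraph[OF lcs g(1,2) z(1) g(3) p0] by metis
  \<comment> \<open>Adding the separation inequality at \<open>p \<in> A\<close> to
    \<open>pairing p z - cpl p \<le> cpl z\<close> gives \<open>fitz A w \<le> s\<close> after
    division by \<open>1 + l\<close>, which is positive even when \<open>l = 0\<close>.\<close>
  define w where "w = (inverse (1 + l) *\<^sub>R (fst z - u), \<lambda>y. inverse (1 + l) * (snd z y - a y))"
  define s where "s = inverse (1 + l) * (cpl z - e - pairing (u, a) z - l * cpl z)"
  have w: "w \<in> UNIV \<times> dual tau"
    using z(1) sep(1) dual_lincomb[of "snd z" tau a "inverse (1 + l)" "- inverse (1 + l)"]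
    by (auto simp: w_def algebra_simps)
  have pw: "(1 + l) * pairing p w = pairing p z - pairing (u, a) p" if "p \<in> UNIV \<times> dual tau" for p
  proof -
    have "linear (snd p)" using that by (auto intro: dual_linear)
    hence "pairing p w = inverse (1 + l) * (pairing p z - pairing (u, a) p)"
      by (simp add: pairing_def w_def linear_scale linear_diff algebra_simps)
    thus ?thesis using sep(2) by simp
  qed
  have s: "(1 + l) * s = cpl z - e - pairing (u, a) z - l * cpl z"
    using sep(2) by (simp add: s_def)
  have "fitz A w \<le> ereal s"
    unfolding fitz_le_iff
  proof
    fix p assume p: "p \<in> A"
    hence pZ: "p \<in> UNIV \<times> dual tau" using A by blast
    have "pairing p z - cpl p \<le> cpl z" using z(2) p by (auto simp: fitz_le_iff)
    hence "(1 + l) * (pairing p w - cpl p) \<le> (1 + l) * s"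
      using sep(4)[OF pZ gA[OF p]] by (simp only: s pw[OF pZ] right_diff_distrib) (simp add: algebra_simps)
    thus "pairing p w - cpl p \<le> s" using sep(2) by (simp add: mult_le_cancel_left)
  qed
  hence "(1 + l) * pairing z w \<le> (1 + l) * (cpl z + s)"
    using sub[OF w] sep(2) by (simp add: mult_le_cancel_left)
  \<comment> \<open>Everything but the gap cancels, leaving \<open>e \<le> 0\<close>.\<close>
  hence "pairing z z - pairing (u, a) z \<le> (1 + l) * cpl z + (cpl z - e - pairing (u, a) z - l * cpl z)"
    by (simp only: pw[OF z(1)] s distrib_left)
  moreover have "pairing z z = 2 * cpl z" by (simp add: pairing_def cpl_def)
  ultimately show False using sep(3) by (simp add: algebra_simps)
qed

section \<open>Representable and maximal monotone extensions under the NI condition\<close>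

theorem theorem3p4:
  fixes tau :: "'x::real_vector topology"
    and T :: "('x \<times> ('x \<Rightarrow> real)) set"
    and V :: "'x set"
  assumes lcs: "lcs tau"
    and nontriv: "\<exists>x::'x. x \<noteq> 0"
    and T_sub: "T \<subseteq> UNIV \<times> dual tau"
    and V_ne: "V \<noteq> {}"
    and V_open: "core V = V"
    and V_conv: "convex V"
    and TV_mono: "monotone_op (restr T V)"
    and TV_ne: "restr T V \<noteq> {}"
    and NI: "V_NI tau T V"
  shows
    "{z \<in> V \<times> dual tau. psi tau (restr T V) z = ereal (cpl z)}
        = {z \<in> V \<times> dual tau. fitz (restr T V) z = ereal (cpl z)}
     \<and> {z \<in> V \<times> dual tau. fitz (restr T V) z = ereal (cpl z)}
        = {z \<in> V \<times> dual tau. fitz (restr T V) z \<le> ereal (cpl z)}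
     \<and> Vrep_ext tau V (restr T V) {z \<in> V \<times> dual tau. psi tau (restr T V) z = ereal (cpl z)}
     \<and> (\<forall>S. Vrep_ext tau V (restr T V) S
            \<longrightarrow> S = {z \<in> V \<times> dual tau. psi tau (restr T V) z = ereal (cpl z)})
     \<and> maxmon_ext_in (V \<times> dual tau) (restr T V)
          {z \<in> V \<times> dual tau. psi tau (restr T V) z = ereal (cpl z)}
     \<and> (\<forall>S. maxmon_ext_in (V \<times> dual tau) (restr T V) S
            \<longrightarrow> S = {z \<in> V \<times> dual tau. psi tau (restr T V) z = ereal (cpl z)})
     \<and> (monotone_op T \<and> T \<noteq> {} \<longrightarrow>
          {z \<in> V \<times> dual tau. psi tau (restr T V) z = ereal (cpl z)}
            = {z \<in> V \<times> dual tau. fitz T z = ereal (cpl z)}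
          \<and> {z \<in> V \<times> dual tau. fitz T z = ereal (cpl z)}
            = {z \<in> V \<times> dual tau. psi tau T z = ereal (cpl z)})
     \<and> (monotone_op T \<and> T \<noteq> {} \<and> V_representable tau T V \<longrightarrow>
          identifies tau V T
          \<and> {z \<in> V \<times> dual tau. psi tau (restr T V) z = ereal (cpl z)} = restr T V)"
proof -
  define A where "A = restr T V"
  let ?Z = "UNIV \<times> dual tau" and ?VZ = "V \<times> dual tau"
  define S0 where "S0 = {z \<in> ?VZ. psi tau A z = ereal (cpl z)}"
  have A_VZ: "A \<subseteq> ?VZ" and A_Z: "A \<subseteq> ?Z" and A_T: "A \<subseteq> T"
    using T_sub by (auto simp: A_def restr_def)
  have A_mono: "monotone_op A" and A_ne: "A \<noteq> {}" using TV_mono TV_ne by (simp_all add: A_def)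
  have restr_V: "restr S V = S" if "S \<subseteq> ?VZ" for S using that by (auto simp: restr_def)
  have meets: "V \<inter> dom_op S \<noteq> {}" if AS: "A \<subseteq> S" for S
  proof -
    obtain p where "p \<in> A" using A_ne by blast
    hence "fst p \<in> V" "fst p \<in> dom_op S" using A_VZ AS by (auto simp: dom_op_def)
    thus ?thesis by blast
  qed
  have fitz_ge: "ereal (cpl z) \<le> fitz A z" if "z \<in> ?VZ" for z
    using NI that unfolding V_NI_def A_def by blast
  have fitz_psi: "fitz A z \<le> psi tau A z" for z by (rule fitz_le_psi[OF lcs A_Z A_mono])
  have psi_ge: "ereal (cpl z) \<le> psi tau A z" if "z \<in> ?Z" for z
    by (rule cpl_le_psi[OF lcs A_Z A_mono that])
  have psi_le: "psi tau A z \<le> ereal (cpl z)" if "z \<in> ?VZ" "fitz A z \<le> ereal (cpl z)" for z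
    using that V_NI_subgradient[OF T_sub V_open NI]
    by (intro psi_le_cpl_of_subgradient[OF lcs A_Z A_ne]) (auto simp: A_def)
  have fitz_eq: "{z \<in> ?VZ. fitz A z = ereal (cpl z)} = {z \<in> ?VZ. fitz A z \<le> ereal (cpl z)}"
    using fitz_ge by (auto intro: order_antisym)
  have S0_le: "S0 = {z \<in> ?VZ. fitz A z \<le> ereal (cpl z)}"
  proof (intro set_eqI iffI)
    fix z assume "z \<in> S0"
    thus "z \<in> {z \<in> ?VZ. fitz A z \<le> ereal (cpl z)}" using fitz_psi[of z] by (simp add: S0_def)
  next
    fix z assume "z \<in> {z \<in> ?VZ. fitz A z \<le> ereal (cpl z)}"
    thus "z \<in> S0" using psi_le[of z] psi_ge[of z] by (auto simp: S0_def intro: order_antisym)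
  qed
  have S0_VZ: "S0 \<subseteq> ?VZ" by (auto simp: S0_def)
  have S0_mono: "monotone_op S0"
    by (rule monotone_op_representative[OF convex_onZ_psi psi_ge]) (auto simp: S0_def)
  \<comment> \<open>Members of a monotone extension are monotonically related to \<open>A\<close>,
    so \<open>S0\<close> contains every such extension; both maximality and uniqueness rest on
    this.\<close>
  have mono_sub: "S \<subseteq> S0" if "monotone_op S" "A \<subseteq> S" "S \<subseteq> ?VZ" for S
    using fitz_le_cpl_of_monotone[OF that(1,2)] that(3) unfolding S0_le by blast
  have A_S0: "A \<subseteq> S0" using mono_sub[OF A_mono _ A_VZ] by simp
  have S0_rep: "Vrep_ext tau V A S0"
  proof -
    obtain p where p: "p \<in> A" using A_ne by blast
    have "proper_onZ tau (psi tau A)"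
      unfolding proper_onZ_def
    proof (intro conjI ballI)
      show "psi tau A z \<noteq> - \<infinity>" if "z \<in> ?Z" for z using psi_ge[OF that] by auto
      show "\<exists>z\<in>?Z. psi tau A z \<noteq> \<infinity>" using psi_le_cpl[OF A_Z p] p A_Z by (intro bexI[of _ p]) auto
    qed
    hence "V_representable tau S0 V"
      unfolding V_representable_def restr_V[OF S0_VZ]
      using meets[OF A_S0] psi_ge convex_onZ_psi[of tau A] lsc_onZ_psi[of tau A] S0_def by blast
    thus ?thesis using A_S0 S0_VZ by (simp add: Vrep_ext_def)
  qed
  have rep_unique: "S = S0" if S: "Vrep_ext tau V A S" for S
  proof -
    have S': "A \<subseteq> S" "S \<subseteq> ?VZ" using S by (auto simp: Vrep_ext_def)
    obtain h where h: "convex_onZ tau h" "lsc_onZ tau h" "\<And>z. z \<in> ?Z \<Longrightarrow> ereal (cpl z) \<le> h z"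
        "{z \<in> ?VZ. h z = ereal (cpl z)} = S"
      using S unfolding Vrep_ext_def V_representable_def restr_V[OF S'(2)] by blast
    have "monotone_op S" using h(4) S'(2) by (intro monotone_op_representative[OF h(1,3)]) auto
    hence "S \<subseteq> S0" by (rule mono_sub[OF _ S'])
    \<comment> \<open>The representative \<open>h\<close> of \<open>S\<close> equals
      \<open>cpl\<close> on \<open>A\<close>, hence lies below \<open>psi tau A\<close>; on
      \<open>S0\<close> it is squeezed between \<open>cpl\<close> and
      \<open>psi tau A = cpl\<close>.\<close>
    moreover have "z \<in> S" if "z \<in> S0" for z
    proof -
      have z: "z \<in> ?VZ" "psi tau A z = ereal (cpl z)" using that by (auto simp: S0_def)
      have "h z \<le> psi tau A z" using S'(1) h(4) by (intro le_psi[OF h(1,2)]) auto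
      hence "h z = ereal (cpl z)" using z h(3)[of z] by (auto intro: order_antisym)
      thus ?thesis using z h(4) by blast
    qed
    ultimately show ?thesis by blast
  qed
  have S0_max: "maxmon_ext_in ?VZ A S0"
    unfolding maxmon_ext_in_def using A_S0 S0_VZ S0_mono mono_sub by blast
  have max_unique: "S = S0" if "maxmon_ext_in ?VZ A S" for S
    using that S0_mono S0_VZ mono_sub[of S] unfolding maxmon_ext_in_def by blast
  \<comment> \<open>A cycle of inclusions, using on \<open>V\<close> the chain \<open>cpl \<le> fitz
    A \<le> fitz T \<le> psi tau T \<le> psi tau A\<close>.\<close>
  have T_eqs: "S0 = {z \<in> ?VZ. fitz T z = ereal (cpl z)}
      \<and> {z \<in> ?VZ. fitz T z = ereal (cpl z)} = {z \<in> ?VZ. psi tau T z = ereal (cpl z)}"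
    if T_mono: "monotone_op T"
  proof -
    have 1: "psi tau T z = ereal (cpl z)" if "z \<in> S0" for z
      using that psi_antimono[OF A_T T_sub, of z] cpl_le_psi[OF lcs T_sub T_mono, of z]
      by (auto simp: S0_def intro: order_antisym)
    have 2: "fitz T z = ereal (cpl z)" if "z \<in> ?VZ" "psi tau T z = ereal (cpl z)" for z
      using that fitz_le_psi[OF lcs T_sub T_mono, of z] fitz_ge[of z] fitz_mono[OF A_T, of z]
      by (auto intro: order_antisym order_trans)
    have 3: "z \<in> S0" if "z \<in> ?VZ" "fitz T z = ereal (cpl z)" for z
      using that fitz_mono[OF A_T, of z] by (simp add: S0_le)
    show ?thesis using 1 2 3 S0_VZ by blast
  qed
  have T_rep: "identifies tau V T \<and> S0 = A" if "V_representable tau T V"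
  proof -
    \<comment> \<open>The function representing \<open>T\<close> on \<open>V\<close> also represents
      \<open>A\<close>, so uniqueness applies to \<open>A\<close> as an extension of itself.\<close>
    have "Vrep_ext tau V A A"
      using that A_VZ restr_V[OF A_VZ] meets[of A]
      by (simp add: Vrep_ext_def V_representable_def A_def)
    hence "S0 = A" using rep_unique by blast
    thus ?thesis using A_T by (auto simp: identifies_def S0_le simp flip: A_def)
  qed
  show ?thesis
    unfolding A_def[symmetric] S0_def[symmetric]
    by (intro conjI allI impI; (elim conjE)?;
        (rule S0_le[folded fitz_eq] fitz_eq S0_rep S0_max
          | rule rep_unique max_unique T_eqs[THEN conjunct1] T_eqs[THEN conjunct2]
              T_rep[THEN conjunct1] T_rep[THEN conjunct2], assumption))
qed

end
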